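(* Let $n\ge 1$ and assume that $A_1,\ldots,A_n\subseteq\mathbb{Z}$ have positive upper Banach densities $\mathrm{BD}(A_i)=\alpha_i$. Then there exists a set $E\subseteq\mathbb{N}$ with $\sigma(E)\ge\prod_{i=1}^n\alpha_i$ and such that $\Delta_\epsilon(E)\subseteq\bigcap_{i=1}^n\Delta_\epsilon(A_i)$ for every real $\epsilon\ge 0$.
   Context: $\mathbb{N}$ is the set of positive integers. The upper Banach density of $A\subseteq\mathbb{Z}$ is $\mathrm{BD}(A)=\lim_{n\to\infty}\max_{x\in\mathbb{Z}}\frac{|A\cap[x+1,x+n]|}{n}=\inf_{n\in\mathbb{N}}\max_{x\in\mathbb{Z}}\frac{|A\cap[x+1,x+n]|}{n}$. The Schnirelmann density of $E\subseteq\mathbb{N}$ is $\sigma(E)=\inf_{n\in\mathbb{N}}|E\cap[1,n]|/n$. For real $\epsilon\ge0$, $\Delta_\epsilon(A)=\{t\in\mathbb{Z}\mid \mathrm{BD}(A\cap(A-t))>\epsilon\}$, where $A-t=\{a-t\mid a\in A\}$. *)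

theory Defs
  imports "HOL-Analysis.Analysis"
begin

definition max_count :: "int set \<Rightarrow> nat \<Rightarrow> nat" where
  "max_count A n = Max (range (\<lambda>x::int. card (A \<inter> {x + 1..x + int n})))"

definition upper_banach_density :: "int set \<Rightarrow> real" where
  "upper_banach_density A = lim (\<lambda>n. real (max_count A n) / real n)"

text \<open>
  Sets of positive integers are represented as subsets of \<open>{1..}\<close> of type \<^typ>\<open>int set\<close>,
  so that the notions for sets of integers apply to them without coercion.
\<close>

definition schnirelmann_density :: "int set \<Rightarrow> real" where
  "schnirelmann_density E = (INF n\<in>{1::nat..}. real (card (E \<inter> {1..int n})) / real n)"

definition delta_set :: "real \<Rightarrow> int set \<Rightarrow> int set" where
  "delta_set \<epsilon> A = {t. upper_banach_density (A \<inter> (\<lambda>a. a - t) ` A) > \<epsilon>}"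


text \<open>
  The maximum in \<^const>\<open>max_count\<close> is taken over a finite set of values, and the limit in
  \<^const>\<open>upper_banach_density\<close> always exists and is equal to the infimum (Fekete's lemma).
\<close>

lemma card_Int_interval_le: "card (A \<inter> {x + 1..x + int n}) \<le> n"
proof -
  have "card (A \<inter> {x + 1..x + int n}) \<le> card {x + 1..x + int n}"
    by (rule card_mono) auto
  then show ?thesis by simp
qed

lemma finite_counts: "finite (range (\<lambda>x::int. card (A \<inter> {x + 1..x + int n})))"
  by (rule finite_subset[of _ "{..n}"]) (use card_Int_interval_le in auto)

lemma card_le_max_count: "card (A \<inter> {x + 1..x + int n}) \<le> max_count A n"
  unfolding max_count_def by (rule Max_ge[OF finite_counts]) auto

lemma max_count_le_iff: "max_count A n \<le> k \<longleftrightarrow> (\<forall>x. card (A \<inter> {x + 1..x + int n}) \<le> k)"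
  unfolding max_count_def using finite_counts[of A n] by (subst Max_le_iff) auto

lemma max_count_le: "max_count A n \<le> n"
  by (simp add: max_count_le_iff card_Int_interval_le)

lemma max_count_add: "max_count A (m + n) \<le> max_count A m + max_count A n"
proof -
  have "card (A \<inter> {x + 1..x + int (m + n)}) \<le> max_count A m + max_count A n" for x
  proof -
    have "A \<inter> {x + 1..x + int (m + n)}
        = (A \<inter> {x + 1..x + int m}) \<union> (A \<inter> {(x + int m) + 1..(x + int m) + int n})"
      by auto
    then have "card (A \<inter> {x + 1..x + int (m + n)})
        \<le> card (A \<inter> {x + 1..x + int m}) + card (A \<inter> {(x + int m) + 1..(x + int m) + int n})"
      by (metis card_Un_le)
    then show ?thesis
      using card_le_max_count[of A x m] card_le_max_count[of A "x + int m" n] by linarith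
  qed
  then show ?thesis by (simp add: max_count_le_iff)
qed

lemma max_count_mult_add: "max_count A (q * m + r) \<le> q * max_count A m + max_count A r"
proof (induction q)
  case (Suc q)
  have "max_count A (Suc q * m + r) \<le> max_count A m + max_count A (q * m + r)"
    using max_count_add[of A m "q * m + r"] by (simp add: algebra_simps)
  with Suc show ?case by simp
qed simp

lemma max_count_tendsto_INF:
  "(\<lambda>n. real (max_count A n) / real n) \<longlonglongrightarrow> (INF n\<in>{1..}. real (max_count A n) / real n)"
    (is "?f \<longlonglongrightarrow> ?L")
proof (rule LIMSEQ_I)
  fix e :: real
  assume e: "e > 0"
  have bdd: "bdd_below (?f ` {1..})" by (rule bdd_belowI[of _ 0]) auto
  obtain m where m: "m \<ge> 1" "?f m < ?L + e / 2"
    using cINF_less_iff[of "{1::nat..}" ?f "?L + e / 2"] bdd e by auto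
  obtain N :: nat where N: "real N > 2 * real m / e" using reals_Archimedean2 by blast
  have "norm (?f n - ?L) < e" if n: "n \<ge> max 1 N" for n
  proof -
    have n1: "n \<ge> 1" and nN: "n \<ge> N" using n by auto
    have lower: "?L \<le> ?f n" by (rule cINF_lower[OF bdd]) (use n1 in auto)
    have "max_count A n \<le> (n div m) * max_count A m + max_count A (n mod m)"
      using max_count_mult_add[of A "n div m" m "n mod m"] by simp
    also have "\<dots> \<le> (n div m) * max_count A m + m"
      using max_count_le[of A "n mod m"] mod_less_divisor[of m n] m(1) by linarith
    finally have "real (max_count A n) \<le> real (n div m) * real (max_count A m) + real m"
      by (metis of_nat_add of_nat_le_iff of_nat_mult)
    also have "\<dots> \<le> (real n / real m) * real (max_count A m) + real m"
      by (intro add_mono mult_right_mono of_nat_div_le_of_nat) auto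
    finally have "?f n \<le> ((real n / real m) * real (max_count A m) + real m) / real n"
      by (rule divide_right_mono) simp
    also have "\<dots> = ?f m + real m / real n" using n1 by (simp add: field_simps)
    finally have "?f n \<le> ?f m + real m / real n" .
    moreover have "real m / real n < e / 2"
    proof -
      have "2 * real m / e < real n" using N nN by linarith
      then show ?thesis using e n1 by (simp add: field_simps)
    qed
    ultimately show ?thesis using lower m(2) unfolding real_norm_def by linarith
  qed
  then show "\<exists>no. \<forall>n\<ge>no. norm (?f n - ?L) < e" by blast
qed

lemma upper_banach_density_eq_INF:
  "upper_banach_density A = (INF n\<in>{1..}. real (max_count A n) / real n)"
  unfolding upper_banach_density_def by (rule limI[OF max_count_tendsto_INF])

end

theory Submission
  imports Defs "HOL-Complex_Analysis.Great_Picard"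
begin

text \<open>
  It suffices to find \<open>E\<close> with the required Schnirelmann density every finite part of which has a
  translate inside each \<open>A i\<close>. Translating a finite part of \<open>E \<inter> (E - t)\<close> together with its shift
  by \<open>t\<close> then puts it inside \<open>A i \<inter> (A i - t)\<close>. Upper Banach density sees only how many points lie
  in windows of each length, wherever these are, so \<open>BD (E \<inter> (E - t)) \<le> BD (A i \<inter> (A i - t))\<close> for
  every \<open>t\<close>. This is the inclusion of the \<open>\<Delta>\<close> sets for all \<open>\<epsilon>\<close> at once
  (\<open>finitely_embeddable_delta_set\<close>).

  The density comes from averaging. If \<open>F\<close> is finite and \<open>y\<close> runs over a very long window in which
  \<open>B\<close> has density at least \<open>BD B\<close>, then \<open>F + y\<close> meets \<open>B\<close> in about \<open>card F * BD B\<close> points on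
  average, and some \<open>y\<close> does at least as well (\<open>exists_translate_meeting_densely\<close>). Starting from
  \<open>F = {1..M}\<close> and treating the sets \<open>A i\<close> in turn, this yields translates of all of them whose
  intersection \<open>S\<close> has at least \<open>p * M\<close> points in \<open>{1..M}\<close>, where \<open>p\<close> is the product of the
  densities.

  A density bound for one long interval becomes a bound for all short initial segments by moving the
  origin (\<open>exists_start_dense_prefixes\<close>): take the point \<open>x\<close> where the walk
  \<open>card (S \<inter> {1..x}) - q * x\<close>, for \<open>q\<close> slightly below \<open>p\<close>, is at its minimum. Since the walk never
  goes below this value up to \<open>M\<close>, every interval that starts just after \<open>x\<close> and ends by \<open>M\<close> has
  density at least \<open>q\<close>.

  Doing this with \<open>q = p - 1 / (N + 1)\<close> and lengths up to \<open>N\<close> gives a sequence of intersections of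
  translates. The set \<open>E\<close> is a pointwise limit of a subsequence: on every finite set it agrees
  with some of these intersections of arbitrarily large index. Hence \<open>E\<close> is finitely embeddable in
  each \<open>A i\<close>, and the losses \<open>1 / (N + 1)\<close> vanish in the limit.
\<close>

section \<open>Upper Banach density under finite embeddings\<close>

lemma upper_banach_density_nonneg: "0 \<le> upper_banach_density A"
  unfolding upper_banach_density_eq_INF by (rule cINF_greatest) auto

lemma upper_banach_density_mono:
  assumes "\<And>L. max_count A L \<le> max_count B L"
  shows "upper_banach_density A \<le> upper_banach_density B"
  unfolding upper_banach_density_eq_INF
proof (rule cINF_mono)
  fix m :: nat assume "m \<in> {1..}"
  then show "\<exists>n\<in>{1..}. real (max_count A n) / real n \<le> real (max_count B m) / real m"
    using assms[of m] by (intro bexI[of _ m] divide_right_mono) auto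
qed (auto intro!: bdd_belowI[of _ 0])

text \<open>
  The bound holds for every length without an error term, because the limit that defines the
  density is also the infimum over all lengths.
\<close>

lemma exists_window_banach_density:
  "\<exists>x. upper_banach_density A * real L \<le> real (card (A \<inter> {x + 1..x + int L}))"
proof (cases "L = 0")
  case False
  have "max_count A L \<in> range (\<lambda>x::int. card (A \<inter> {x + 1..x + int L}))"
    unfolding max_count_def by (rule Max_in[OF finite_counts]) auto
  then obtain x where x: "max_count A L = card (A \<inter> {x + 1..x + int L})" by auto
  have "upper_banach_density A \<le> real (max_count A L) / real L"
    unfolding upper_banach_density_eq_INF
    by (rule cINF_lower) (use False in \<open>auto intro!: bdd_belowI[of _ 0]\<close>)
  then show ?thesis using x False by (intro exI[of _ x]) (simp add: field_simps)
qed auto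

definition finitely_embeddable :: "int set \<Rightarrow> int set \<Rightarrow> bool" where
  "finitely_embeddable E A \<longleftrightarrow> (\<forall>F. finite F \<and> F \<subseteq> E \<longrightarrow> (\<exists>y. \<forall>x\<in>F. x + y \<in> A))"

text \<open>
  A single translation has to serve both \<open>x\<close> and \<open>x + t\<close>, so the embedding is applied to the finite
  set \<open>F \<union> (F + t)\<close>, which is again part of \<open>E\<close>.
\<close>

lemma finitely_embeddable_Int_shift:
  assumes "finitely_embeddable E A"
  shows "finitely_embeddable (E \<inter> (\<lambda>a. a - t) ` E) (A \<inter> (\<lambda>a. a - t) ` A)"
  unfolding finitely_embeddable_def
proof (intro allI impI)
  fix F assume F: "finite F \<and> F \<subseteq> E \<inter> (\<lambda>a. a - t) ` E"
  then have "finite (F \<union> (\<lambda>x. x + t) ` F)" "F \<union> (\<lambda>x. x + t) ` F \<subseteq> E" by auto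
  then obtain y where y: "\<forall>x\<in>F \<union> (\<lambda>x. x + t) ` F. x + y \<in> A"
    using assms unfolding finitely_embeddable_def by meson
  have "x + y \<in> A \<inter> (\<lambda>a. a - t) ` A" if "x \<in> F" for x
  proof -
    have "x + t + y \<in> A" "x + y \<in> A" using y that by auto
    moreover have "x + y = (x + t + y) - t" by simp
    ultimately show ?thesis by blast
  qed
  then show "\<exists>y. \<forall>x\<in>F. x + y \<in> A \<inter> (\<lambda>a. a - t) ` A" by blast
qed

lemma finitely_embeddable_density_le:
  assumes "finitely_embeddable E A"
  shows "upper_banach_density E \<le> upper_banach_density A"
proof (rule upper_banach_density_mono)
  fix L
  have "card (E \<inter> {x + 1..x + int L}) \<le> max_count A L" for x
  proof -
    have "finite (E \<inter> {x + 1..x + int L})" "E \<inter> {x + 1..x + int L} \<subseteq> E" by auto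
    then obtain y where y: "\<forall>z\<in>E \<inter> {x + 1..x + int L}. z + y \<in> A"
      using assms unfolding finitely_embeddable_def by meson
    have "card (E \<inter> {x + 1..x + int L}) \<le> card (A \<inter> {(x + y) + 1..(x + y) + int L})"
      by (rule card_inj_on_le[of "\<lambda>z. z + y"]) (use y in auto)
    also have "\<dots> \<le> max_count A L" by (rule card_le_max_count)
    finally show ?thesis .
  qed
  then show "max_count E L \<le> max_count A L" by (simp add: max_count_le_iff)
qed

lemma finitely_embeddable_delta_set:
  assumes "finitely_embeddable E A"
  shows "delta_set \<epsilon> E \<subseteq> delta_set \<epsilon> A"
  using finitely_embeddable_density_le[OF finitely_embeddable_Int_shift[OF assms]]
  unfolding delta_set_def by (auto intro: less_le_trans)

section \<open>Dense common translates\<close>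

text \<open>
  Moving a window by \<open>f\<close> loses only the points at one of its ends, at most \<open>\<bar>f\<bar>\<close> of them. This is
  the boundary error in the averaging argument, and it does not grow with the length \<open>L\<close>.
\<close>

lemma card_window_shift:
  fixes f x :: int
  shows "card (B \<inter> {x + 1..x + int L})
    \<le> card {y \<in> {x + 1..x + int L}. f + y \<in> B} + nat \<bar>f\<bar>"
proof -
  let ?W = "{x + 1..x + int L}"
  \<comment> \<open>One of the two end pieces is empty, according to the sign of \<open>f\<close>.\<close>
  have "B \<inter> ?W \<subseteq> (\<lambda>y. f + y) ` {y \<in> ?W. f + y \<in> B}
      \<union> ({x + 1..x + f} \<union> {x + int L + f + 1..x + int L})" (is "_ \<subseteq> ?P \<union> ?Q")
  proof
    fix b assume b: "b \<in> B \<inter> ?W"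
    show "b \<in> ?P \<union> ?Q"
    proof (cases "b - f \<in> ?W")
      case True
      then have "b - f \<in> {y \<in> ?W. f + y \<in> B}" using b by simp
      then have "f + (b - f) \<in> ?P" by (rule imageI)
      then show ?thesis by simp
    next
      case False
      then show ?thesis using b by auto
    qed
  qed
  moreover have "finite {y \<in> ?W. f + y \<in> B}" by (rule finite_subset[of _ ?W]) auto
  then have "finite (?P \<union> ?Q)" by blast
  ultimately have "card (B \<inter> ?W) \<le> card (?P \<union> ?Q)" by (rule card_mono[rotated])
  also have "\<dots> \<le> card ?P + card ?Q" by (rule card_Un_le)
  also have "card ?P = card {y \<in> ?W. f + y \<in> B}" by (rule card_image) (auto simp: inj_on_def)
  also have "card ?Q \<le> nat \<bar>f\<bar>"
    using card_Un_le[of "{x + 1..x + f}" "{x + int L + f + 1..x + int L}"] by simp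
  finally show ?thesis by simp
qed

lemma card_of_bool:
  assumes "finite X"
  shows "card {x \<in> X. P x} = (\<Sum>x\<in>X. of_bool (P x))"
  using assms by (simp add: Int_def)

text \<open>
  Count the pairs \<open>(f, y)\<close> with \<open>f + y \<in> B\<close> in two ways, where \<open>y\<close> runs over a window of length
  \<open>L\<close> that is rich in \<open>B\<close>. Summed over \<open>f\<close> the count is at least \<open>card F * BD B * L\<close> up to a
  boundary error independent of \<open>L\<close>; summed over \<open>y\<close> it is at most \<open>L\<close> times the best value.
  As \<open>L\<close> grows the error disappears. A best value exists because the counts are bounded natural
  numbers, which is why the conclusion holds without an \<open>\<epsilon>\<close>.
\<close>

lemma exists_translate_meeting_densely:
  fixes F B :: "int set"
  assumes F: "finite F"
  shows "\<exists>y. upper_banach_density B * real (card F) \<le> real (card {f \<in> F. f + y \<in> B})"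
proof -
  let ?\<beta> = "upper_banach_density B"
  define h where "h y = card {f \<in> F. f + y \<in> B}" for y
  have "h y < Suc (card F)" for y
    unfolding h_def less_Suc_eq_le by (rule card_mono[OF F]) auto
  then obtain y0 where y0: "\<And>y. h y \<le> h y0"
    using Lattices_Big.ex_has_greatest_nat[of "\<lambda>_. True" 0 h "Suc (card F)"] by blast
  define s where "s = (\<Sum>f\<in>F. nat \<bar>f\<bar>)"
  have key: "?\<beta> * real (card F) * real L \<le> real (h y0) * real L + real s" for L
  proof -
    obtain x where x: "?\<beta> * real L \<le> real (card (B \<inter> {x + 1..x + int L}))"
      using exists_window_banach_density by blast
    let ?W = "{x + 1..x + int L}"
    have "card F * card (B \<inter> ?W) = (\<Sum>f\<in>F. card (B \<inter> ?W))" by simp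
    also have "\<dots> \<le> (\<Sum>f\<in>F. card {y \<in> ?W. f + y \<in> B} + nat \<bar>f\<bar>)"
      by (intro sum_mono card_window_shift)
    also have "\<dots> = (\<Sum>f\<in>F. \<Sum>y\<in>?W. of_bool (f + y \<in> B)) + s"
      by (simp only: sum.distrib s_def card_of_bool[OF finite_atLeastAtMost_int])
    also have "(\<Sum>f\<in>F. \<Sum>y\<in>?W. of_bool (f + y \<in> B)) = (\<Sum>y\<in>?W. \<Sum>f\<in>F. of_bool (f + y \<in> B))"
      by (rule sum.swap)
    also have "\<dots> = (\<Sum>y\<in>?W. h y)"
      by (simp only: h_def card_of_bool[OF F])
    also have "\<dots> \<le> (\<Sum>y\<in>?W. h y0)" by (intro sum_mono y0)
    also have "\<dots> = h y0 * L" by simp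
    finally have "card F * card (B \<inter> ?W) \<le> h y0 * L + s" by simp
    then have "real (card F) * real (card (B \<inter> ?W)) \<le> real (h y0) * real L + real s"
      by (metis of_nat_add of_nat_le_iff of_nat_mult)
    moreover have "real (card F) * (?\<beta> * real L) \<le> real (card F) * real (card (B \<inter> ?W))"
      using x by (intro mult_left_mono) auto
    ultimately show ?thesis by (simp add: mult_ac)
  qed
  have "?\<beta> * real (card F) \<le> real (h y0)"
  proof (rule ccontr)
    assume "\<not> ?thesis"
    then have "0 < ?\<beta> * real (card F) - real (h y0)" by simp
    then obtain L where "real s < real L * (?\<beta> * real (card F) - real (h y0))"
      using reals_Archimedean3 by blast
    with key[of L] show False by (simp add: algebra_simps)
  qed
  then show ?thesis unfolding h_def by blast
qed

text \<open>
  Each new set is met by a translate of what the previous sets have left of \<open>F\<close>, so the densities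
  multiply.
\<close>

lemma exists_translates_meeting_densely:
  fixes A :: "'i \<Rightarrow> int set"
  assumes "finite I" and F: "finite F"
  shows "\<exists>y. (\<Prod>i\<in>I. upper_banach_density (A i)) * real (card F)
    \<le> real (card {x \<in> F. \<forall>i\<in>I. x + y i \<in> A i})"
  using assms(1)
proof induction
  case (insert j I)
  let ?p = "\<Prod>i\<in>I. upper_banach_density (A i)"
  obtain y where y: "?p * real (card F) \<le> real (card {x \<in> F. \<forall>i\<in>I. x + y i \<in> A i})"
    using insert.IH by blast
  define G where "G = {x \<in> F. \<forall>i\<in>I. x + y i \<in> A i}"
  have "finite G" using F by (simp add: G_def)
  then obtain z where z: "upper_banach_density (A j) * real (card G)
      \<le> real (card {x \<in> G. x + z \<in> A j})"
    using exists_translate_meeting_densely by blast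
  have "upper_banach_density (A j) * (?p * real (card F)) \<le> upper_banach_density (A j) * real (card G)"
    using y by (intro mult_left_mono upper_banach_density_nonneg) (simp add: G_def)
  also note z
  also have "{x \<in> G. x + z \<in> A j} = {x \<in> F. \<forall>i\<in>insert j I. x + (y(j := z)) i \<in> A i}"
    using insert.hyps by (auto simp: G_def)
  finally show ?case
    using insert.hyps by (intro exI[of _ "y(j := z)"]) (simp add: mult.assoc)
qed auto

section \<open>From average density to dense initial segments\<close>

text \<open>
  For negative \<open>q\<close> every origin works. Otherwise start where the walk \<open>g x = card (S \<inter> {1..x}) - q * x\<close> is minimal on \<open>{0..M}\<close>. An interval that
  begins there and stays inside \<open>{1..M}\<close> cannot have density below \<open>q\<close>. The walk starts at \<open>0\<close>, ends
  at \<open>\<delta> * M\<close> or higher and climbs by at most one per step, so its minimum lies more than \<open>N\<close> steps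
  before the end and there is room for all the lengths up to \<open>N\<close>.
\<close>

lemma exists_start_dense_prefixes:
  fixes S :: "int set" and q \<delta> :: real
  assumes dens: "(q + \<delta>) * real M \<le> real (card (S \<inter> {1..int M}))"
    and long: "real N < \<delta> * real M"
  shows "\<exists>x. \<forall>m\<le>N. q * real m \<le> real (card (S \<inter> {x + 1..x + int m}))"
proof (cases "q \<ge> 0")
  case False
  then have "q * real m \<le> 0" for m by (simp add: mult_nonpos_nonneg)
  then show ?thesis by (meson of_nat_0_le_iff order_trans)
next
  case True
  define g where "g x = real (card (S \<inter> {1..int x})) - q * real x" for x :: nat
  have g_add: "g (x + m) - g x = real (card (S \<inter> {int x + 1..int x + int m})) - q * real m" for x m
  proof -
    have "S \<inter> {1..int (x + m)} = (S \<inter> {1..int x}) \<union> (S \<inter> {int x + 1..int x + int m})" by auto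
    moreover have "card \<dots> = card (S \<inter> {1..int x}) + card (S \<inter> {int x + 1..int x + int m})"
      by (rule card_Un_disjoint) auto
    ultimately show ?thesis by (simp add: g_def algebra_simps)
  qed
  define x where "x = arg_min_on g {..M}"
  have x: "x \<le> M" "\<And>y. y \<le> M \<Longrightarrow> g x \<le> g y"
    using arg_min_if_finite(1)[of "{..M}" g] arg_min_least[of "{..M}" _ g]
    unfolding x_def by auto
  have "x + N \<le> M"
  proof (rule ccontr)
    assume far: "\<not> ?thesis"
    have "g M - g x \<le> real (card (S \<inter> {int x + 1..int x + int (M - x)}))"
      using g_add[of x "M - x"] x(1) True by simp
    also have "\<dots> \<le> real N" using card_Int_interval_le[of S "int x" "M - x"] far by simp
    finally have "g M - g x \<le> real N" .
    moreover have "g x \<le> 0" using x(2)[of 0] by (simp add: g_def)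
    moreover have "\<delta> * real M \<le> g M" using dens by (simp add: g_def algebra_simps)
    ultimately show False using long by linarith
  qed
  then have "q * real m \<le> real (card (S \<inter> {int x + 1..int x + int m}))" if "m \<le> N" for m
    using g_add[of x m] x(2)[of "x + m"] that by simp
  then show ?thesis by blast
qed

text \<open>
  The new origin is absorbed into the translations: a shift of an intersection of translates of the
  \<open>A i\<close> is again such an intersection.
\<close>

lemma exists_translates_dense_prefixes:
  fixes A :: "'i \<Rightarrow> int set" and \<delta> :: real
  assumes I: "finite I" and \<delta>: "\<delta> > 0"
  shows "\<exists>y. \<forall>m\<le>N. ((\<Prod>i\<in>I. upper_banach_density (A i)) - \<delta>) * real m
    \<le> real (card ({x. \<forall>i\<in>I. x + y i \<in> A i} \<inter> {1..int m}))"
proof -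
  let ?p = "\<Prod>i\<in>I. upper_banach_density (A i)"
  obtain M :: nat where M: "real N < real M * \<delta>" using reals_Archimedean3[OF \<delta>] by blast
  obtain y where y: "?p * real (card {1..int M})
      \<le> real (card {x \<in> {1..int M}. \<forall>i\<in>I. x + y i \<in> A i})"
    using exists_translates_meeting_densely[OF I, of "{1..int M}"] by blast
  define S where "S = {x. \<forall>i\<in>I. x + y i \<in> A i}"
  have "{x \<in> {1..int M}. \<forall>i\<in>I. x + y i \<in> A i} = S \<inter> {1..int M}" by (auto simp: S_def)
  with y obtain x where x: "\<forall>m\<le>N. (?p - \<delta>) * real m \<le> real (card (S \<inter> {x + 1..x + int m}))"
    using exists_start_dense_prefixes[of "?p - \<delta>" \<delta> M S N] M by (auto simp: mult.commute)
  have "card (S \<inter> {x + 1..x + int m}) =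
      card ({z. \<forall>i\<in>I. z + (x + y i) \<in> A i} \<inter> {1..int m})" for m
  proof -
    have "S \<inter> {x + 1..x + int m} = (+) x ` ({z. \<forall>i\<in>I. z + (x + y i) \<in> A i} \<inter> {1..int m})"
      (is "_ = _ ` ?Z")
    proof
      show "S \<inter> {x + 1..x + int m} \<subseteq> (+) x ` ?Z"
      proof
        fix s assume "s \<in> S \<inter> {x + 1..x + int m}"
        then have "s - x \<in> ?Z" by (auto simp: S_def)
        then have "x + (s - x) \<in> (+) x ` ?Z" by (rule imageI)
        then show "s \<in> (+) x ` ?Z" by simp
      qed
    qed (auto simp: S_def algebra_simps)
    then show ?thesis by (simp add: card_image)
  qed
  with x show ?thesis by (intro exI[of _ "\<lambda>i. x + y i"]) simp
qed

section \<open>Passing to a limit set\<close>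

text \<open>
  Sequential compactness of the Cantor space of subsets of a countable type, obtained from real-valued
  indicator functions. These take only the values \<open>0\<close> and \<open>1\<close>, so pointwise convergence means
  that membership of each point, and hence the trace on each finite set, is eventually constant.
\<close>

lemma pointwise_convergent_subsequence_of_sets:
  fixes S :: "nat \<Rightarrow> 'a::countable set"
  obtains E k where "strict_mono (k :: nat \<Rightarrow> nat)"
    and "\<And>F. finite F \<Longrightarrow> eventually (\<lambda>j. S (k j) \<inter> F = E \<inter> F) sequentially"
proof -
  obtain k :: "nat \<Rightarrow> nat" where k: "strict_mono k"
    and lim: "\<And>x. x \<in> UNIV \<Longrightarrow> \<exists>l. (\<lambda>j. indicat_real (S (k j)) x) \<longlonglongrightarrow> l"
    by (rule function_convergent_subsequence[of UNIV "\<lambda>j. indicat_real (S j)" 1])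
      (auto simp: indicator_def)
  define E where "E = {x. eventually (\<lambda>j. x \<in> S (k j)) sequentially}"
  have "eventually (\<lambda>j. x \<in> S (k j) \<longleftrightarrow> x \<in> E) sequentially" for x
  proof -
    have "Cauchy (\<lambda>j. indicat_real (S (k j)) x)" using lim[of x] LIMSEQ_imp_Cauchy by auto
    \<comment> \<open>Two indicator values at distance less than \<open>1\<close> are equal.\<close>
    then obtain J where J: "\<And>j. j \<ge> J \<Longrightarrow> dist (indicat_real (S (k j)) x) (indicat_real (S (k J)) x) < 1"
      unfolding Cauchy_def by (meson le_refl zero_less_one)
    have const: "x \<in> S (k j) \<longleftrightarrow> x \<in> S (k J)" if "j \<ge> J" for j
      using J[OF that] by (auto simp: indicator_def dist_real_def split: if_splits)
    have "x \<in> E \<longleftrightarrow> x \<in> S (k J)"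
      unfolding E_def eventually_sequentially mem_Collect_eq by (meson const nat_le_linear order_refl)
    with const show ?thesis unfolding eventually_sequentially by blast
  qed
  then have "eventually (\<lambda>j. \<forall>x\<in>F. x \<in> S (k j) \<longleftrightarrow> x \<in> E) sequentially" if "finite F" for F
    by (intro eventually_ball_finite[OF that]) blast
  then have "eventually (\<lambda>j. S (k j) \<inter> F = E \<inter> F) sequentially" if "finite F" for F
    using that by (force elim: eventually_mono)
  with k show thesis by (rule that)
qed

text \<open>
  Both properties of \<open>E\<close> concern finite sets only, and on these \<open>E\<close> agrees with late members of a
  sequence of intersections of translates. The \<open>N\<close>-th member has good density on lengths up to \<open>N\<close>
  with loss \<open>1 / (N + 1)\<close>, so for a fixed length \<open>m\<close> all late members qualify and their loss tends
  to \<open>0\<close>.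
\<close>

lemma exists_dense_common_finitely_embeddable:
  fixes A :: "'i \<Rightarrow> int set"
  assumes I: "finite I"
  shows "\<exists>E \<subseteq> {1..}. schnirelmann_density E \<ge> (\<Prod>i\<in>I. upper_banach_density (A i))
    \<and> (\<forall>i\<in>I. finitely_embeddable E (A i))"
proof -
  let ?p = "\<Prod>i\<in>I. upper_banach_density (A i)"
  have "\<forall>N. \<exists>y. \<forall>m\<le>N. (?p - 1 / real (Suc N)) * real m
      \<le> real (card ({x. \<forall>i\<in>I. x + y i \<in> A i} \<inter> {1..int m}))"
    by (intro allI exists_translates_dense_prefixes I) simp
  from choice[OF this] obtain y where y: "\<And>N m. m \<le> N \<Longrightarrow> (?p - 1 / real (Suc N)) * real m
      \<le> real (card ({x. \<forall>i\<in>I. x + y N i \<in> A i} \<inter> {1..int m}))"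
    by blast
  define S where "S N = {x. \<forall>i\<in>I. x + y N i \<in> A i}" for N
  obtain E' k where k: "strict_mono (k :: nat \<Rightarrow> nat)"
    and E': "\<And>F. finite F \<Longrightarrow> eventually (\<lambda>j. S (k j) \<inter> F = E' \<inter> F) sequentially"
    using pointwise_convergent_subsequence_of_sets[of S] by blast
  \<comment> \<open>Dropping the integers below \<open>1\<close> changes none of the counts in \<open>{1..m}\<close>, and a subset of a
    finitely embeddable set is finitely embeddable.\<close>
  define E where "E = E' \<inter> {1..}"
  have dense: "?p \<le> real (card (E \<inter> {1..int m})) / real m" if "m \<ge> 1" for m
  proof -
    have "eventually (\<lambda>j. S (k j) \<inter> {1..int m} = E' \<inter> {1..int m} \<and> m \<le> j) sequentially"
      by (intro eventually_conj E' eventually_ge_at_top) simp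
    then have "eventually (\<lambda>j. ?p - 1 / real (Suc (k j)) \<le> real (card (E \<inter> {1..int m})) / real m)
        sequentially"
    proof eventually_elim
      case (elim j)
      then have "m \<le> k j" using seq_suble[OF k, of j] by simp
      then have "(?p - 1 / real (Suc (k j))) * real m \<le> real (card (S (k j) \<inter> {1..int m}))"
        using y[of m "k j"] by (simp add: S_def)
      also have "S (k j) \<inter> {1..int m} = E \<inter> {1..int m}" using elim by (auto simp: E_def)
      finally show ?case using that by (simp add: pos_le_divide_eq)
    qed
    moreover have "(\<lambda>j. ?p - 1 / real (Suc (k j))) \<longlonglongrightarrow> ?p - 0"
      using LIMSEQ_subseq_LIMSEQ[OF LIMSEQ_inverse_real_of_nat k]
      by (intro tendsto_diff tendsto_const) (simp add: o_def inverse_eq_divide)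
    ultimately have "?p - 0 \<le> real (card (E \<inter> {1..int m})) / real m"
      by (intro tendsto_upperbound) auto
    then show ?thesis by simp
  qed
  have "finitely_embeddable E (A i)" if "i \<in> I" for i
    unfolding finitely_embeddable_def
  proof (intro allI impI)
    fix F assume F: "finite F \<and> F \<subseteq> E"
    then obtain j where "S (k j) \<inter> F = E' \<inter> F"
      using eventually_happens'[OF _ E'[of F]] by auto
    then have "F \<subseteq> S (k j)" using F by (auto simp: E_def)
    then show "\<exists>y. \<forall>x\<in>F. x + y \<in> A i" using that by (auto simp: S_def)
  qed
  moreover have "?p \<le> schnirelmann_density E"
    unfolding schnirelmann_density_def by (rule cINF_greatest) (auto intro: dense)
  ultimately show ?thesis by (intro exI[of _ E]) (auto simp: E_def)
qed

theorem corollary5p3: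
  fixes n :: nat and A :: "nat \<Rightarrow> int set" and \<alpha> :: "nat \<Rightarrow> real"
  assumes "n \<ge> 1"
    and "\<And>i. i \<in> {1..n} \<Longrightarrow> upper_banach_density (A i) = \<alpha> i"
    and "\<And>i. i \<in> {1..n} \<Longrightarrow> \<alpha> i > 0"
  shows "\<exists>E. E \<subseteq> {1..} \<and> schnirelmann_density E \<ge> (\<Prod>i=1..n. \<alpha> i) \<and>
    (\<forall>\<epsilon>\<ge>0. delta_set \<epsilon> E \<subseteq> (\<Inter>i\<in>{1..n}. delta_set \<epsilon> (A i)))"
proof -
  have "(\<Prod>i=1..n. upper_banach_density (A i)) = (\<Prod>i=1..n. \<alpha> i)"
    by (rule prod.cong) (use assms(2) in auto)
  then obtain E where "E \<subseteq> {1..}" "schnirelmann_density E \<ge> (\<Prod>i=1..n. \<alpha> i)"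
    and "\<forall>i\<in>{1..n}. finitely_embeddable E (A i)"
    using exists_dense_common_finitely_embeddable[of "{1..n}" A] by auto
  then show ?thesis
    using finitely_embeddable_delta_set by (intro exI[of _ E]) blast
qed

end
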